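(* For every $f\in\mathbb Q[x,y]$, $$\sum_{r\geq0}\mathcal G_r f(x,y)\,z^r=f\left(\frac{x}{1-yz},\ \frac{y(1-yz+xz)}{1-yz}\right),$$ where the right-hand side is expanded as a formal power series at $z=0$.
   Context: Work over $\mathbb Q$. With $D=\partial_x+\partial_y$, $\mathcal G_0=\mathrm{id}$ and, for $r\geq1$, $\mathcal G_r=y^r\sum_{j=1}^{r}\binom{r-1}{j-1}\frac{x^j}{j!}D^j$, operators on $\mathbb Q[x,y]$. The identity is in $\mathbb Q[x,y][[z]]$. *)

theory Defs
  imports "HOL-Computational_Algebra.Computational_Algebra"
begin

text \<open>
  The ring \<open>\<rat>[x, y]\<close> is represented as \<open>(\<rat>[x])[y]\<close>: the inner indeterminate is \<open>x\<close>, the outer one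
  is \<open>y\<close>, so the coefficient of \<open>x\<^sup>i y\<^sup>j\<close> in \<open>f\<close> is \<open>coeff (coeff f j) i\<close>. The ring
  \<open>\<rat>[x, y][[z]]\<close> is \<open>rat poly poly fps\<close>, with \<open>z = fps_X\<close>.
\<close>

type_synonym bipoly = "rat poly poly"

definition constP :: "rat \<Rightarrow> bipoly" where
  "constP c = [:[:c:]:]"

definition varX :: bipoly where
  "varX = [:[:0, 1:]:]"

definition varY :: bipoly where
  "varY = [:0, 1:]"

definition partial_x :: "bipoly \<Rightarrow> bipoly" where
  "partial_x f = map_poly pderiv f"

definition partial_y :: "bipoly \<Rightarrow> bipoly" where
  "partial_y f = pderiv f"

definition Dop :: "bipoly \<Rightarrow> bipoly" where
  "Dop f = partial_x f + partial_y f"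

definition Gop :: "nat \<Rightarrow> bipoly \<Rightarrow> bipoly" where
  "Gop r f = (if r = 0 then f
     else varY ^ r * (\<Sum>j = 1..r.
            constP (of_nat ((r - 1) choose (j - 1)) / fact j) * varX ^ j * (Dop ^^ j) f))"

text \<open>
  \<open>subst_xy f a b\<close> is \<open>f(a, b)\<close>, the image of \<open>f\<close> under the homomorphism of \<open>\<rat>\<close>-algebras
  that sends \<open>x\<close> to \<open>a\<close> and \<open>y\<close> to \<open>b\<close>. The coefficients lie in \<open>\<rat>\<close>, so the occurrences of \<open>x\<close> and
  \<open>y\<close> inside \<open>a\<close> and \<open>b\<close> are not affected.
\<close>

definition subst_xy :: "bipoly \<Rightarrow> bipoly fps \<Rightarrow> bipoly fps \<Rightarrow> bipoly fps" where
  "subst_xy f a b =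
     poly (map_poly (\<lambda>p. poly (map_poly (\<lambda>c. fps_const (constP c)) p) a) f) b"

lemma subst_xy_altdef:
  "subst_xy f a b = (\<Sum>j\<le>degree f. \<Sum>i\<le>degree (coeff f j).
     fps_const (constP (coeff (coeff f j) i)) * a ^ i * b ^ j)"
proof -
  have inner: "poly (map_poly (\<lambda>c. fps_const (constP c)) p) a =
      (\<Sum>i\<le>degree p. fps_const (constP (coeff p i)) * a ^ i)" for p
  proof -
    have "degree (map_poly (\<lambda>c. fps_const (constP c)) p) = degree p"
      by (rule degree_map_poly) (auto simp: constP_def)
    then show ?thesis
      by (simp add: poly_altdef coeff_map_poly constP_def)
  qed
  let ?h = "\<lambda>p. poly (map_poly (\<lambda>c. fps_const (constP c)) p) a"
  have "degree (map_poly ?h f) \<le> degree f"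
    by (rule map_poly_degree_leq)
  then have "poly (map_poly ?h f) b = (\<Sum>j\<le>degree f. coeff (map_poly ?h f) j * b ^ j)"
    by (subst poly_altdef, intro sum.mono_neutral_left) (auto simp: coeff_eq_0)
  also have "\<dots> = (\<Sum>j\<le>degree f. ?h (coeff f j) * b ^ j)"
    by (simp add: coeff_map_poly)
  finally show ?thesis
    unfolding subst_xy_def by (simp add: inner sum_distrib_right)
qed

text \<open>
  The expansion at \<open>z = 0\<close> of \<open>1 / (1 - y z)\<close>. As \<open>\<rat>[x, y]\<close> has no \<open>inverse\<close> operation, the series
  is inverted by \<open>fps_right_inverse\<close>, which takes the inverse \<open>1\<close> of the constant coefficient as
  its second argument.
\<close>

definition inv_one_minus_yz :: "bipoly fps" where
  "inv_one_minus_yz = fps_right_inverse (1 - fps_const varY * fps_X) 1"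

lemma inv_one_minus_yz: "(1 - fps_const varY * fps_X) * inv_one_minus_yz = 1"
  unfolding inv_one_minus_yz_def by (rule fps_right_inverse) simp

end

theory Submission
  imports Defs
begin

text \<open>
  Put \<open>t = x y z / (1 - y z)\<close>. The two substituted series are \<open>x + t\<close> and \<open>y + t\<close>, so the right-hand
  side is the Taylor expansion \<open>\<Sum>\<^sub>j t\<^sup>j D\<^sup>j f / j!\<close>, and the coefficient of \<open>z\<^sup>r\<close> in \<open>t\<^sup>j\<close> is
  \<open>(r - 1 choose j - 1) x\<^sup>j y\<^sup>r\<close>. The Taylor formula itself holds because \<open>f \<mapsto> \<Sum>\<^sub>j t\<^sup>j D\<^sup>j f / j!\<close> is
  linear and turns multiplication by \<open>x\<close> and \<open>y\<close> into multiplication by \<open>x + t\<close> and \<open>y + t\<close>; this is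
  the Leibniz rule \<open>D\<^sup>j (x f) = x D\<^sup>j f + j D\<^sup>j\<^sup>-\<^sup>1 f\<close>.
\<close>

section \<open>Rational constants and the derivation \<open>Dop\<close>\<close>

lemma constP_0 [simp]: "constP 0 = 0"
  and constP_1 [simp]: "constP 1 = 1"
  by (simp_all add: constP_def one_pCons)

lemma constP_mult: "constP (a * b) = constP a * constP b"
  by (simp add: constP_def)

lemma constP_of_nat: "constP (of_nat n) = of_nat n"
  by (simp add: constP_def of_nat_poly)

lemma Dop_add: "Dop (f + g) = Dop f + Dop g"
proof -
  have "map_poly pderiv (f + g) = map_poly pderiv f + map_poly pderiv g"
    by (intro poly_eqI) (simp add: coeff_map_poly pderiv_add)
  then show ?thesis
    by (simp add: Dop_def partial_x_def partial_y_def pderiv_add)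
qed

lemma Dop_0 [simp]: "Dop 0 = 0"
  by (simp add: Dop_def partial_x_def partial_y_def)

lemma Dop_constP [simp]: "Dop (constP c) = 0"
  by (simp add: Dop_def partial_x_def partial_y_def constP_def map_poly_pCons pderiv_pCons)

lemma Dop_varX_mult: "Dop (varX * f) = f + varX * Dop f"
proof -
  have "map_poly pderiv (varX * f) = f + varX * map_poly pderiv f"
    by (intro poly_eqI) (simp add: varX_def coeff_map_poly pderiv_pCons)
  moreover have "pderiv (varX * f) = varX * pderiv f"
    by (simp add: varX_def pderiv_smult)
  ultimately show ?thesis
    by (simp add: Dop_def partial_x_def partial_y_def algebra_simps)
qed

lemma Dop_varY_mult: "Dop (varY * f) = f + varY * Dop f"
proof -
  have "map_poly pderiv (varY * f) = varY * map_poly pderiv f"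
    by (simp add: varY_def map_poly_pCons)
  moreover have "pderiv (varY * f) = f + varY * pderiv f"
    by (simp add: varY_def pderiv_pCons)
  ultimately show ?thesis
    by (simp add: Dop_def partial_x_def partial_y_def algebra_simps)
qed

lemma Dop_funpow_add: "(Dop ^^ n) (f + g) = (Dop ^^ n) f + (Dop ^^ n) g"
  by (induction n) (simp_all add: Dop_add)

lemma Dop_funpow_0 [simp]: "(Dop ^^ n) 0 = 0"
  by (induction n) simp_all

lemma Dop_of_nat_mult: "Dop (of_nat n * f) = of_nat n * Dop f"
  by (induction n) (simp_all add: Dop_add distrib_right)

text \<open>The hypothesis says that \<open>Dop\<close> is a derivation with value 1 at
  \<open>v\<close>, so one induction serves both \<open>varX\<close> and
  \<open>varY\<close>.\<close>

lemma Dop_funpow_mult: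
  assumes "\<And>g. Dop (v * g) = g + v * Dop g"
  shows "(Dop ^^ Suc n) (v * f) = v * (Dop ^^ Suc n) f + of_nat (Suc n) * (Dop ^^ n) f"
proof (induction n)
  case 0
  show ?case by (simp add: assms)
next
  case (Suc n)
  have "(Dop ^^ Suc (Suc n)) (v * f) = Dop ((Dop ^^ Suc n) (v * f))"
    by simp
  also have "\<dots> = Dop (v * (Dop ^^ Suc n) f + of_nat (Suc n) * (Dop ^^ n) f)"
    by (simp only: Suc)
  also have "\<dots> = v * (Dop ^^ Suc (Suc n)) f + of_nat (Suc (Suc n)) * (Dop ^^ Suc n) f"
    by (simp only: Dop_add assms Dop_of_nat_mult) (simp add: algebra_simps)
  finally show ?case .
qed

text \<open>Taylor coefficient in the direction (1,1). Dividing by the factorial absorbs the factor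
  \<open>Suc n\<close> of the Leibniz rule.\<close>

definition Dterm :: "nat \<Rightarrow> bipoly \<Rightarrow> bipoly" where
  "Dterm j f = constP (1 / fact j) * (Dop ^^ j) f"

lemma Dterm_0 [simp]: "Dterm 0 f = f"
  by (simp add: Dterm_def)

lemma Dterm_add: "Dterm j (f + g) = Dterm j f + Dterm j g"
  by (simp add: Dterm_def Dop_funpow_add distrib_left)

lemma Dterm_Suc_constP [simp]: "Dterm (Suc j) (constP c) = 0"
  by (simp add: Dterm_def funpow_swap1)

lemma Dterm_mult:
  assumes "\<And>g. Dop (v * g) = g + v * Dop g"
  shows "Dterm (Suc j) (v * f) = v * Dterm (Suc j) f + Dterm j f"
proof -
  have "(1 / fact (Suc j) :: rat) * of_nat (Suc j) = 1 / fact j"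
    by (simp add: divide_simps)
  then have *: "constP (1 / fact (Suc j)) * of_nat (Suc j) = constP (1 / fact j)"
    by (metis constP_mult constP_of_nat)
  have "Dterm (Suc j) (v * f) = v * Dterm (Suc j) f
      + (constP (1 / fact (Suc j)) * of_nat (Suc j)) * (Dop ^^ j) f"
    unfolding Dterm_def Dop_funpow_mult[OF assms] by (simp only: algebra_simps)
  then show ?thesis
    unfolding * Dterm_def .
qed

section \<open>Powers of the series t of the overview, here \<open>shift\<close>\<close>

definition shift :: "bipoly fps" where
  "shift = fps_const (varX * varY) * fps_X * inv_one_minus_yz"

text \<open>Since (1 - yz) t = xyz, also (1 - yz) t^(j+1) = xyz t^j; compare coefficients of
  z^(r+1).\<close>

lemma shift_power_Suc_nth:
  "shift ^ Suc j $ Suc r = varY * (shift ^ Suc j $ r) + varX * varY * (shift ^ j $ r)"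
proof -
  have "(1 - fps_const varY * fps_X) * shift = fps_const (varX * varY) * fps_X"
    using inv_one_minus_yz unfolding shift_def by (metis mult.left_commute mult.right_neutral)
  then have "(1 - fps_const varY * fps_X) * shift ^ Suc j
      = fps_const (varX * varY) * fps_X * shift ^ j"
    by (simp add: mult.assoc [symmetric])
  then have "shift ^ Suc j
      = fps_const varY * (fps_X * shift ^ Suc j) + fps_const (varX * varY) * (fps_X * shift ^ j)"
    by (simp only: algebra_simps mult_1_left)
  then have "shift ^ Suc j $ Suc r
      = (fps_const varY * (fps_X * shift ^ Suc j)
         + fps_const (varX * varY) * (fps_X * shift ^ j)) $ Suc r"
    by (rule arg_cong)
  then show ?thesis
    by (simp del: power_Suc)
qed

text \<open>Up to monomials, the recurrence is Pascal's rule. The case r = 0 is separate because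
  truncated subtraction would make the binomial 1 at j = 0.\<close>

lemma shift_power_nth:
  "shift ^ Suc j $ r = (if r = 0 then 0 else varY ^ r * of_nat ((r - 1) choose j) * varX ^ Suc j)"
proof (induction r arbitrary: j)
  case 0
  show ?case by (simp add: shift_def)
next
  case (Suc r)
  show ?case
  proof (cases j)
    \<comment> \<open>The recurrence now involves t^0 = 1, which the induction hypothesis does not
      cover; it contributes only when r = 0.\<close>
    case 0
    show ?thesis
      unfolding shift_power_Suc_nth Suc.IH 0 by (cases r) (simp_all add: algebra_simps)
  next
    case (Suc k)
    show ?thesis
      unfolding shift_power_Suc_nth Suc.IH Suc by (cases r) (simp_all add: algebra_simps)
  qed
qed

lemma shift_power_nth_eq_0: "r < j \<Longrightarrow> shift ^ j $ r = 0"
  by (cases j) (auto simp: shift_power_nth binomial_eq_0 simp del: power_Suc)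

text \<open>This is the coefficient of z^r in the Taylor sum: t^j is divisible by z^j, so j \<le> r
  suffices. For r > 0 the term j = 0 vanishes.\<close>

lemma Gop_eq_sum: "Gop r f = (\<Sum>j\<le>r. shift ^ j $ r * Dterm j f)"
proof (cases r)
  case 0
  then show ?thesis by (simp add: Gop_def)
next
  case (Suc m)
  have "(\<Sum>j\<le>Suc m. shift ^ j $ Suc m * Dterm j f)
      = (\<Sum>j\<le>m. shift ^ Suc j $ Suc m * Dterm (Suc j) f)"
    by (subst sum.atMost_Suc_shift) simp
  also have "\<dots> = (\<Sum>j\<le>m. varY ^ Suc m *
      (constP (of_nat (m choose j) / fact (Suc j)) * varX ^ Suc j * (Dop ^^ Suc j) f))"
  proof (rule sum.cong)
    fix j
    have "constP (of_nat (m choose j) / fact (Suc j))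
        = of_nat (m choose j) * constP (1 / fact (Suc j))"
      unfolding constP_of_nat [symmetric] constP_mult [symmetric] by simp
    then show "shift ^ Suc j $ Suc m * Dterm (Suc j) f = varY ^ Suc m *
      (constP (of_nat (m choose j) / fact (Suc j)) * varX ^ Suc j * (Dop ^^ Suc j) f)"
      unfolding shift_power_nth Dterm_def
      by (simp only: nat.simps if_False diff_Suc_1 mult_ac)
  qed simp
  also have "\<dots> = Gop (Suc m) f"
    unfolding Gop_def One_nat_def sum.shift_bounds_cl_Suc_ivl
    by (simp only: sum_distrib_left atLeast0AtMost nat.simps if_False diff_Suc_Suc diff_zero)
  finally show ?thesis
    using Suc by simp
qed

section \<open>The generating series and its multiplication rule\<close>

definition Gseries :: "bipoly \<Rightarrow> bipoly fps" where
  "Gseries f = Abs_fps (\<lambda>r. Gop r f)"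

lemma Gseries_nth: "Gseries f $ r = (\<Sum>j\<le>r. shift ^ j $ r * Dterm j f)"
  by (simp add: Gseries_def Gop_eq_sum)

lemma Gseries_add: "Gseries (f + g) = Gseries f + Gseries g"
  by (rule fps_ext) (simp add: Gseries_nth Dterm_add distrib_left sum.distrib)

lemma Gseries_constP: "Gseries (constP c) = fps_const (constP c)"
proof (rule fps_ext)
  fix r
  have "Gseries (constP c) $ r = (\<Sum>j\<in>{0}. shift ^ j $ r * Dterm j (constP c))"
    unfolding Gseries_nth
  proof (rule sum.mono_neutral_right)
    show "\<forall>j\<in>{..r} - {0}. shift ^ j $ r * Dterm j (constP c) = 0"
      by (metis Diff_iff Dterm_Suc_constP insertI1 mult_zero_right not0_implies_Suc)
  qed auto
  then show "Gseries (constP c) $ r = fps_const (constP c) $ r"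
    by simp
qed

lemma shift_mult_Gseries_nth:
  "(shift * Gseries f) $ r = (\<Sum>j\<le>r. shift ^ Suc j $ r * Dterm j f)"
proof -
  \<comment> \<open>A bound independent of s allows the sums to be swapped, after which each inner
    sum is a Cauchy product.\<close>
  have extend: "Gseries f $ s = (\<Sum>j\<le>r. shift ^ j $ s * Dterm j f)" if "s \<le> r" for s
    unfolding Gseries_nth
    by (rule sum.mono_neutral_left) (use that in \<open>auto simp: shift_power_nth_eq_0\<close>)
  have "(shift * Gseries f) $ r = (\<Sum>i=0..r. \<Sum>j\<le>r. shift $ i * (shift ^ j $ (r - i)) * Dterm j f)"
    unfolding fps_mult_nth
    by (rule sum.cong) (simp_all add: extend sum_distrib_left mult.assoc)
  also have "\<dots> = (\<Sum>j\<le>r. \<Sum>i=0..r. shift $ i * (shift ^ j $ (r - i)) * Dterm j f)"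
    by (rule sum.swap)
  also have "\<dots> = (\<Sum>j\<le>r. shift ^ Suc j $ r * Dterm j f)"
    by (simp add: fps_mult_nth sum_distrib_right)
  finally show ?thesis .
qed

text \<open>Of the two summands in \<open>Dterm_mult\<close>, the first yields multiplication by v
  and the second, with its index lowered by one, multiplication by t.\<close>

lemma Gseries_mult:
  assumes "\<And>g. Dop (v * g) = g + v * Dop g"
  shows "Gseries (v * f) = (fps_const v + shift) * Gseries f"
proof (rule fps_ext)
  fix r
  have "Gseries (v * f) $ r = v * Gseries f $ r + (shift * Gseries f) $ r"
  proof (cases r)
    case 0
    then show ?thesis by (simp add: Gseries_nth shift_def)
  next
    case (Suc m)
    have split: "Gseries g $ Suc m = shift ^ 0 $ Suc m * g
        + (\<Sum>j\<le>m. shift ^ Suc j $ Suc m * Dterm (Suc j) g)" for g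
      unfolding Gseries_nth by (subst sum.atMost_Suc_shift) (simp del: power_Suc)
    \<comment> \<open>The last term j = m + 1 drops out, as t^(m+2) has no z^(m+1).\<close>
    have "(shift * Gseries f) $ Suc m = (\<Sum>j\<le>m. shift ^ Suc j $ Suc m * Dterm j f)"
      unfolding shift_mult_Gseries_nth by (simp add: shift_power_nth_eq_0 del: power_Suc)
    then show ?thesis
      unfolding Suc split Dterm_mult[OF assms]
      by (simp add: algebra_simps sum.distrib sum_distrib_left del: power_Suc)
  qed
  then show "Gseries (v * f) $ r = ((fps_const v + shift) * Gseries f) $ r"
    by (simp add: distrib_right)
qed

section \<open>Comparison with the substitution by Horner's scheme\<close>

lemma subst_xy_pCons: "subst_xy (pCons p f) a b = subst_xy [:p:] a b + b * subst_xy f a b"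
  by (simp add: subst_xy_def map_poly_pCons)

lemma subst_xy_pCons_const:
  "subst_xy [:pCons c p:] a b = fps_const (constP c) + a * subst_xy [:p:] a b"
  by (simp add: subst_xy_def map_poly_pCons)

text \<open>Both sides obey the same Horner recursion, first in y over the outer coefficients, then
  in x inside each coefficient.\<close>

lemma Gseries_eq_subst_xy:
  "Gseries f = subst_xy f (fps_const varX + shift) (fps_const varY + shift)"
proof (induction f)
  case 0
  show ?case
    using Gseries_constP[of 0] by (simp add: subst_xy_def)
next
  case (pCons p f)
  have "Gseries [:p:] = subst_xy [:p:] (fps_const varX + shift) (fps_const varY + shift)" for p
  proof (induction p)
    case 0
    show ?case
      using Gseries_constP[of 0] by (simp add: subst_xy_def)
  next
    case (pCons c p)
    have "[:pCons c p:] = constP c + varX * [:p:]"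
      by (simp add: constP_def varX_def)
    then have "Gseries [:pCons c p:]
        = fps_const (constP c) + (fps_const varX + shift) * Gseries [:p:]"
      by (simp only: Gseries_add Gseries_constP Gseries_mult Dop_varX_mult)
    then show ?case
      by (simp only: pCons.IH subst_xy_pCons_const)
  qed
  moreover have "pCons p f = [:p:] + varY * f"
    by (simp add: varY_def)
  then have "Gseries (pCons p f) = Gseries [:p:] + (fps_const varY + shift) * Gseries f"
    by (simp only: Gseries_add Gseries_mult Dop_varY_mult)
  ultimately show ?case
    by (simp only: pCons.IH subst_xy_pCons[of p f])
qed

theorem lemma4:
  fixes f :: "rat poly poly"
  shows "Abs_fps (\<lambda>r. Gop r f) =
    subst_xy f
      (fps_const varX * inv_one_minus_yz)
      (fps_const varY * (1 - fps_const varY * fps_X + fps_const varX * fps_X) * inv_one_minus_yz)"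
proof -
  let ?X = "fps_const varX" and ?Y = "fps_const varY" and ?I = inv_one_minus_yz
  have I: "?I = 1 + ?Y * fps_X * ?I"
    using inv_one_minus_yz by (simp add: algebra_simps)
  have "?X * ?I = ?X + shift"
    by (subst I) (simp add: shift_def algebra_simps flip: fps_const_mult)
  \<comment> \<open>Split the numerator so that 1 - yz cancels against its inverse; what remains is
    t.\<close>
  moreover have "?Y * (1 - ?Y * fps_X + ?X * fps_X) * ?I
      = ?Y * ((1 - ?Y * fps_X) * ?I) + ?X * ?Y * fps_X * ?I"
    by (simp only: algebra_simps)
  then have "?Y * (1 - ?Y * fps_X + ?X * fps_X) * ?I = ?Y + shift"
    unfolding inv_one_minus_yz by (simp add: shift_def)
  ultimately show ?thesis
    using Gseries_eq_subst_xy[of f] by (simp add: Gseries_def)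
qed

end
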